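(* Let $\omega=(\omega_k)_{k\ge 0}\subset(0,+\infty)$ be a weight with $\omega_0=1$, $\lim_{k\to\infty}\omega_k/\omega_{k+1}=1$, and such that for some constant $C>0$ one has $\sup_{n\ge 0}\ \sup_{n\le k\le 2n}\omega_k/\omega_n\le C$. Let $H^2_\omega$ be the corresponding weighted Hardy space on the unit disc, and assume that $H^2_\omega$ has no extraneous zeros. Then the only entire functions which are $H^2_\omega$-inner are the normalized monomials; that is, an entire function $f$ (restricted to the unit disc) is $H^2_\omega$-inner if and only if there are an integer $s\ge 0$ and a constant $c\in\mathbb{C}$ with $|c|^2\omega_s=1$ such that $f(z)=c\,z^s$ for all $z$.
   Context: Notation: $\mathbb{D}$ is the open unit disc in $\mathbb{C}$, $\mathbb{T}$ its boundary circle, $\overline{\mathbb{D}}$ the closed disc, and $\mathbb{N}=\{0,1,2,\dots\}$. Weighted Hardy space. For a weight $\omega$ as in the claim, $H^2_\omega$ is the Hilbert space of holomorphic functions $f(z)=\sum_{k\ge0}a_kz^k$ on $\mathbb{D}$ with $\|f\|_\omega^2:=\sum_{k\ge 0}|a_k|^2\omega_k<\infty$, with inner product $\langle f,g\rangle_\omega=\sum_{k\ge0}a_k\overline{b_k}\,\omega_k$ for $g(z)=\sum_{k\ge 0} b_kz^k$. Inner functions. A function $f\in H^2_\omega$ is $H^2_\omega$-inner if for all $k\in\mathbb{N}$, $\langle z^kf,f\rangle_\omega$ equals $1$ if $k=0$ and equals $0$ if $k\ge1$. Reproducing kernels. For $a\in\mathbb{D}$, the reproducing kernel of $H^2_\omega$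 at $a$ is $k_a(z)=\sum_{k\ge0}\overline{a}^kz^k/\omega_k$. For $a\in\mathbb{T}$, the reproducing kernel at $a$ exists (i.e. evaluation at $a$ is a bounded functional) exactly when $\sum_{k\ge0}1/\omega_k<\infty$; in that case it is given by the same formula, and all functions in $H^2_\omega$ extend continuously to $\overline{\mathbb{D}}$. Shapiro-Shields functions. Let $Z=(z_1,\dots,z_t)$ be a finite tuple of points, with repetitions representing multiplicities. The points are taken in $\mathbb{D}$; points of $\mathbb{T}$ are also allowed when the reproducing kernels at points of $\mathbb{T}$ exist. If the $z_j$ are pairwise distinct and nonzero, the Shapiro-Shields function of $Z$ is $h_Z=f_Z/\|f_Z\|_\omega$, where $f_Z(z)$ is the determinant of the $(t+1)\times(t+1)$ matrix whose first row is $(1,1,\dots,1)$ and whose $(j+1)$-th row, for $j=1,\dots,t$, is $\big(k_{z_j}(z),\,k_{z_j}(z_1),\,\dots,\,k_{z_j}(z_t)\big)$. (For $t=0$, $h_Z=1$.) If some points of $Z$ are repeated or equal to $0$, then $h_Z$ is defined as the limit in $H^2_\omega$, determined up to a unimodular constant factor, of the Shapiro-Shields functions $h_{Z_n}$ for any sequence of $t$-tuples $Z_n$ of pairwise distinct nonzero points converging to $Z$ in $\mathbb{C}^t$. Extraneous zeros. Let $Z$ be a finite tuple in $\overline{\mathbb{D}}$ for which $h_Z$ is defined, let $z_0\in\overline{\mathbb{D}}$, and let $m\ge0$ be the number of times $z_0$ appears in $Z$. The function $h_Z$ is regular at $z_0$ if $|h_Z(z)|$ is comparable to $|z-z_0|^m$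 as $z\to z_0$, i.e. there are constants $0<c_1\le c_2$ and a neighbourhood $U$ of $z_0$ such that $c_1|z-z_0|^m\le|h_Z(z)|\le c_2|z-z_0|^m$ for all $z\in U\cap\overline{\mathbb{D}}$, $z\neq z_0$. Otherwise $z_0$ is called an extraneous zero of $h_Z$. The space $H^2_\omega$ has no extraneous zeros if no Shapiro-Shields function of $H^2_\omega$ has an extraneous zero in $\overline{\mathbb{D}}$. *)

theory Defs
  imports "HOL-Complex_Analysis.Complex_Analysis" "Jordan_Normal_Form.Determinant"
begin

section \<open>The weighted Hardy space\<close>

definition taylor_coeff :: "(complex \<Rightarrow> complex) \<Rightarrow> nat \<Rightarrow> complex" where
  "taylor_coeff f k = (deriv ^^ k) f 0 / fact k"

text \<open>Elements of the space are represented by functions on the whole plane; everything in this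
  section depends only on their values in the open unit disc.\<close>

definition hardy_space :: "(nat \<Rightarrow> real) \<Rightarrow> (complex \<Rightarrow> complex) set" where
  "hardy_space \<omega> = {f. f holomorphic_on ball 0 1 \<and>
     summable (\<lambda>k. (cmod (taylor_coeff f k))\<^sup>2 * \<omega> k)}"

definition hardy_inner :: "(nat \<Rightarrow> real) \<Rightarrow> (complex \<Rightarrow> complex) \<Rightarrow> (complex \<Rightarrow> complex) \<Rightarrow> complex" where
  "hardy_inner \<omega> f g = (\<Sum>k. taylor_coeff f k * cnj (taylor_coeff g k) * of_real (\<omega> k))"

definition hardy_norm :: "(nat \<Rightarrow> real) \<Rightarrow> (complex \<Rightarrow> complex) \<Rightarrow> real" where
  "hardy_norm \<omega> f = sqrt (\<Sum>k. (cmod (taylor_coeff f k))\<^sup>2 * \<omega> k)"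

definition inner_function :: "(nat \<Rightarrow> real) \<Rightarrow> (complex \<Rightarrow> complex) \<Rightarrow> bool" where
  "inner_function \<omega> f \<longleftrightarrow> f \<in> hardy_space \<omega> \<and>
     (\<forall>k::nat. hardy_inner \<omega> (\<lambda>z. z ^ k * f z) f = (if k = 0 then 1 else 0))"


section \<open>Reproducing kernels and Shapiro-Shields functions\<close>

definition rep_kernel :: "(nat \<Rightarrow> real) \<Rightarrow> complex \<Rightarrow> complex \<Rightarrow> complex" where
  "rep_kernel \<omega> a z = (\<Sum>k. cnj a ^ k * z ^ k / of_real (\<omega> k))"

text \<open>The points of the closed disc at which the reproducing kernel exists: a point of the unit
  circle qualifies exactly when the reciprocals of the weight are summable.\<close>

definition kernel_points :: "(nat \<Rightarrow> real) \<Rightarrow> complex set" where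
  "kernel_points \<omega> = (if summable (\<lambda>k. 1 / \<omega> k) then cball 0 1 else ball 0 1)"

definition ss_matrix :: "(nat \<Rightarrow> real) \<Rightarrow> complex list \<Rightarrow> complex \<Rightarrow> complex mat" where
  "ss_matrix \<omega> Z z = Matrix.mat (length Z + 1) (length Z + 1)
     (\<lambda>(i, j). if i = 0 then 1
               else if j = 0 then rep_kernel \<omega> (Z ! (i - 1)) z
               else rep_kernel \<omega> (Z ! (i - 1)) (Z ! (j - 1)))"

definition ss_det :: "(nat \<Rightarrow> real) \<Rightarrow> complex list \<Rightarrow> complex \<Rightarrow> complex" where
  "ss_det \<omega> Z z = Determinant.det (ss_matrix \<omega> Z z)"

definition ss_generic :: "(nat \<Rightarrow> real) \<Rightarrow> complex list \<Rightarrow> complex \<Rightarrow> complex" where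
  "ss_generic \<omega> Z z = ss_det \<omega> Z z / of_real (hardy_norm \<omega> (ss_det \<omega> Z))"

definition generic_tuple :: "(nat \<Rightarrow> real) \<Rightarrow> complex list \<Rightarrow> bool" where
  "generic_tuple \<omega> Z \<longleftrightarrow> set Z \<subseteq> kernel_points \<omega> \<and> distinct Z \<and> 0 \<notin> set Z"

text \<open>The limit function of a tuple with repeated or zero entries is determined only up to a
  unimodular constant, and the functions of the approximating tuples converge only after
  multiplication by suitable unimodular constants; hence a relation rather than a function.
  Convergence in the Hardy space fixes \<open>h\<close> on the open disc; its values on the unit circle,
  which matter for zeros there, are those of the continuous extension.\<close>

definition shapiro_shields :: "(nat \<Rightarrow> real) \<Rightarrow> complex list \<Rightarrow> (complex \<Rightarrow> complex) \<Rightarrow> bool" where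
  "shapiro_shields \<omega> Z h \<longleftrightarrow> set Z \<subseteq> kernel_points \<omega> \<and>
     (if generic_tuple \<omega> Z then \<forall>z\<in>cball 0 1. h z = ss_generic \<omega> Z z
      else h \<in> hardy_space \<omega> \<and> continuous_on (cball 0 1) h \<and>
        (\<forall>W :: nat \<Rightarrow> complex list.
           (\<forall>n. length (W n) = length Z \<and> generic_tuple \<omega> (W n)) \<and>
           (\<forall>j<length Z. (\<lambda>n. W n ! j) \<longlonglongrightarrow> Z ! j) \<longrightarrow>
           (\<exists>c :: nat \<Rightarrow> complex. (\<forall>n. cmod (c n) = 1) \<and>
              (\<lambda>n. hardy_norm \<omega> (\<lambda>z. c n * ss_generic \<omega> (W n) z - h z)) \<longlonglongrightarrow> 0)))"


section \<open>Extraneous zeros\<close>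

definition regular_at :: "complex list \<Rightarrow> (complex \<Rightarrow> complex) \<Rightarrow> complex \<Rightarrow> bool" where
  "regular_at Z h z0 \<longleftrightarrow>
     (\<exists>c1 c2 :: real. \<exists>U. 0 < c1 \<and> c1 \<le> c2 \<and> open U \<and> z0 \<in> U \<and>
        (\<forall>z \<in> U \<inter> cball 0 1. z \<noteq> z0 \<longrightarrow>
           c1 * cmod (z - z0) ^ count_list Z z0 \<le> cmod (h z) \<and>
           cmod (h z) \<le> c2 * cmod (z - z0) ^ count_list Z z0))"

definition extraneous_zero :: "complex list \<Rightarrow> (complex \<Rightarrow> complex) \<Rightarrow> complex \<Rightarrow> bool" where
  "extraneous_zero Z h z0 \<longleftrightarrow> z0 \<in> cball 0 1 \<and> \<not> regular_at Z h z0"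

definition no_extraneous_zeros :: "(nat \<Rightarrow> real) \<Rightarrow> bool" where
  "no_extraneous_zeros \<omega> \<longleftrightarrow>
     (\<forall>Z h. shapiro_shields \<omega> Z h \<longrightarrow> (\<nexists>z0. extraneous_zero Z h z0))"

end

theory Submission
  imports Defs
begin

text \<open>
  Let \<open>f\<close> be an entire inner function with Taylor coefficients \<open>t\<^sub>n\<close>, let \<open>s\<close> be its order of
  vanishing at the origin, and put \<open>d\<^sub>n = cnj t\<^sub>n * \<omega>\<^sub>n\<close>. Being inner implies that
  \<open>\<Sum>\<^sub>j t\<^sub>j d\<^sub>j\<^sub>+\<^sub>k = 0\<close> for all \<open>k \<ge> 1\<close>. The \<open>t\<^sub>n\<close> decay faster than every geometric sequence,
  and the weight grows at most geometrically because the quotients of consecutive weights tend to 1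
  (\<open>weight_exponential_bound\<close>). So the \<open>d\<^sub>n\<close> also decay faster than every geometric sequence, and
  \<open>B(z) = \<Sum>\<^sub>n d\<^sub>n z\<^sup>n\<close> is entire. The vanishing sums are the coefficients of the negative powers in
  the Laurent series of \<open>f(z) B(1/z)\<close>, so this product extends holomorphically to the origin.
  Dividing by \<open>f\<close> shows that \<open>B(1/z)\<close> has at most a pole of order \<open>s\<close> there, so \<open>B\<close> is a
  polynomial of degree at most \<open>s\<close>. Therefore \<open>t\<^sub>n = 0\<close> for \<open>n > s\<close>, and \<open>t\<^sub>n = 0\<close> for \<open>n < s\<close> by
  the choice of \<open>s\<close>: the function \<open>f\<close> is a monomial. Which monomials are inner is a direct
  computation (\<open>inner_function_monomial_iff\<close>).

  The division by \<open>f\<close> is carried out on coefficients, in \<open>correlation_zero_imp_tail_zero\<close>, by a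
  contraction estimate in a geometrically weighted supremum norm. This norm is the
  counterpart of working on a small circle around the origin on which \<open>f(z)/z\<^sup>s\<close> stays close to
  its value at the origin.
\<close>

section \<open>Taylor coefficients of entire functions\<close>

lemma taylor_coeff_has_fps_expansion:
  assumes "f has_fps_expansion F"
  shows "taylor_coeff f n = fps_nth F n"
  using fps_nth_fps_expansion[OF assms, of n] by (simp add: taylor_coeff_def)

lemma taylor_coeff_monomial:
  "taylor_coeff (\<lambda>z. c * z ^ s) n = (if n = s then c else 0)"
proof -
  have "(\<lambda>z. c * z ^ s) has_fps_expansion fps_const c * fps_X ^ s"
    by (intro fps_expansion_intros)
  then show ?thesis
    by (simp add: taylor_coeff_has_fps_expansion)
qed

lemma taylor_coeff_times_power:
  assumes "f holomorphic_on UNIV"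
  shows "taylor_coeff (\<lambda>z. z ^ k * f z) n = (if n < k then 0 else taylor_coeff f (n - k))"
proof -
  have F: "f has_fps_expansion fps_expansion f 0"
    using assms by (intro analytic_at_imp_has_fps_expansion_0)
      (auto simp: analytic_at)
  then have "(\<lambda>z. z ^ k * f z) has_fps_expansion fps_X ^ k * fps_expansion f 0"
    by (intro fps_expansion_intros)
  then show ?thesis
    by (simp add: taylor_coeff_has_fps_expansion[OF F] taylor_coeff_has_fps_expansion
        fps_X_power_mult_nth)
qed

lemma taylor_coeff_entire_sums:
  assumes "f holomorphic_on UNIV"
  shows "(\<lambda>n. taylor_coeff f n * z ^ n) sums f z"
  using holomorphic_power_series[of f 0 "norm z + 1" z] assms
  by (auto simp: taylor_coeff_def intro: holomorphic_on_subset)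

lemma taylor_coeff_entire_bound:
  assumes "f holomorphic_on UNIV" and "R \<ge> 0"
  obtains K where "\<And>n. cmod (taylor_coeff f n) * R ^ n \<le> K"
proof -
  have "summable (\<lambda>n. taylor_coeff f n * of_real R ^ n)"
    using taylor_coeff_entire_sums[OF assms(1)] by (rule sums_summable)
  then have "Bseq (\<lambda>n. taylor_coeff f n * of_real R ^ n)"
    by (rule convergent_imp_Bseq[OF convergentI[OF summable_LIMSEQ_zero]])
  then obtain K where "\<And>n. cmod (taylor_coeff f n * of_real R ^ n) \<le> K"
    by (auto elim!: BseqE)
  with assms(2) show thesis
    by (intro that[of K]) (simp add: norm_mult norm_power)
qed

section \<open>Decay estimates\<close>

lemma weight_exponential_bound:
  fixes \<omega> :: "nat \<Rightarrow> real"
  assumes pos: "\<And>k. \<omega> k > 0"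
    and lim: "(\<lambda>k. \<omega> k / \<omega> (k + 1)) \<longlonglongrightarrow> 1"
  obtains M where "\<And>k. \<omega> k \<le> M * 2 ^ k"
proof -
  have "eventually (\<lambda>k. \<omega> k / \<omega> (k + 1) > 1/2) sequentially"
    using lim by (rule order_tendstoD) simp
  then obtain N where N: "\<And>k. k \<ge> N \<Longrightarrow> \<omega> k / \<omega> (k + 1) > 1/2"
    by (auto simp: eventually_sequentially)
  have step: "\<omega> (Suc k) \<le> 2 * \<omega> k" if "k \<ge> N" for k
    using N[OF that] pos[of "Suc k"] by (simp add: field_simps)
  define M where "M = (\<Sum>k\<le>N. \<omega> k)"
  have init: "\<omega> k \<le> M" if "k \<le> N" for k
    unfolding M_def using that pos by (intro member_le_sum) (auto intro: less_imp_le)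
  have M0: "M \<ge> 0"
    using init[of 0] pos[of 0] by simp
  have "\<omega> k \<le> M * 2 ^ k" for k
  proof (induction k)
    case 0
    then show ?case using init[of 0] by simp
  next
    case (Suc k)
    show ?case
    proof (cases "k \<ge> N")
      case True
      then show ?thesis using step[of k] Suc by simp
    next
      case False
      have "M * 1 \<le> M * 2 ^ Suc k"
        using M0 by (intro mult_left_mono) (auto simp del: power_Suc)
      then show ?thesis using init[of "Suc k"] False by simp
    qed
  qed
  then show thesis by (rule that)
qed

text \<open>
  The relation with index \<open>k\<close> expresses \<open>a 0 * b k\<close> through the later entries of \<open>b\<close>. Since \<open>b\<close>
  decays faster than every geometric sequence, it is bounded after division by \<open>q ^ k\<close> with \<open>q\<close>
  as small as desired. A small \<open>q\<close> makes the leading coefficient \<open>a 0\<close> dominate: every bound for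
  the rescaled tail can then be halved, so the tail is zero.
\<close>
lemma correlation_zero_imp_tail_zero:
  fixes a b :: "nat \<Rightarrow> complex"
  assumes a0: "a 0 \<noteq> 0"
    and a: "\<And>j. cmod (a j) \<le> A"
    and b: "\<And>T. T > 0 \<Longrightarrow> \<exists>K. \<forall>k. cmod (b k) * T ^ k \<le> K"
    and sums: "\<And>k. k \<ge> 1 \<Longrightarrow> (\<lambda>j. a j * b (j + k)) sums 0"
    and "n \<ge> 1"
  shows "b n = 0"
proof -
  have A: "A > 0"
    using a0 a[of 0] by (smt (verit) zero_less_norm_iff)
  \<comment> \<open>The value of \<open>q\<close> solves \<open>A * (q + q\<^sup>2 + \<dots>) = cmod (a 0) / 2\<close>.\<close>
  define q where "q = cmod (a 0) / (2 * A + cmod (a 0))"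
  have q: "0 < q" "q < 1"
    using A a0 by (auto simp: q_def field_simps add_pos_pos)
  have den: "2 * A + cmod (a 0) > 0"
    using A by (simp add: add_pos_nonneg)
  have "1 - q = 2 * A / (2 * A + cmod (a 0))"
    using den by (simp add: q_def field_simps)
  then have geom: "A * q / (1 - q) = cmod (a 0) / 2"
    using den A by (simp add: q_def)
  define \<beta> where "\<beta> k = cmod (b k) / q ^ k" for k
  obtain K where K: "\<And>k. \<beta> k \<le> K"
    using b[of "1 / q"] q by (auto simp: \<beta>_def power_one_over divide_simps)
  have halve: "\<beta> k \<le> L / 2" if L: "\<And>k. k \<ge> 1 \<Longrightarrow> \<beta> k \<le> L" and k: "k \<ge> 1" for L k
  proof -
    have tail: "(\<lambda>j. a (Suc j) * b (Suc j + k)) sums (- (a 0 * b k))"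
      using sums[OF k] sums_Suc_iff[of "\<lambda>j. a j * b (j + k)" "- (a 0 * b k)"] by simp
    have maj: "(\<lambda>j. A * L * q ^ k * q * q ^ j) sums (A * L * q ^ k * q * (1 / (1 - q)))"
      using q by (intro sums_mult geometric_sums) auto
    have le: "cmod (a (Suc j) * b (Suc j + k)) \<le> A * L * q ^ k * q * q ^ j" for j
    proof -
      have "cmod (b (Suc j + k)) \<le> L * q ^ (Suc j + k)"
        using L[of "Suc j + k"] q by (simp add: \<beta>_def divide_simps)
      then have "cmod (a (Suc j)) * cmod (b (Suc j + k)) \<le> A * (L * q ^ (Suc j + k))"
        using a A by (intro mult_mono) auto
      then show ?thesis
        by (simp add: norm_mult power_add mult_ac)
    qed
    have "cmod (- (a 0 * b k)) \<le> A * L * q ^ k * q * (1 / (1 - q))"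
      using tail maj le by (rule norm_sums_le)
    also have "\<dots> = L * q ^ k * (A * q / (1 - q))"
      by simp
    also have "\<dots> = cmod (a 0) * (L / 2 * q ^ k)"
      unfolding geom by simp
    finally have "cmod (a 0) * cmod (b k) \<le> cmod (a 0) * (L / 2 * q ^ k)"
      by (simp add: norm_mult)
    then have "cmod (b k) \<le> L / 2 * q ^ k"
      using a0 by simp
    then show ?thesis
      using q by (simp add: \<beta>_def divide_simps)
  qed
  have bound: "\<beta> k \<le> K * (1/2) ^ m" if "k \<ge> 1" for k m
    using that
  proof (induction m arbitrary: k)
    case 0
    then show ?case using K by simp
  next
    case (Suc m)
    then show ?case using halve[of "K * (1/2) ^ m" k] by simp
  qed
  have "(\<lambda>m. K * (1/2) ^ m) \<longlonglongrightarrow> K * 0"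
    by (intro tendsto_mult_left LIMSEQ_power_zero) simp
  then have "\<beta> n \<le> K * 0"
    by (rule LIMSEQ_le_const) (use bound \<open>n \<ge> 1\<close> in blast)
  then have "cmod (b n) \<le> 0"
    using q by (simp add: \<beta>_def divide_simps)
  then show ?thesis by simp
qed

section \<open>Inner functions\<close>

lemma inner_function_monomial_iff:
  assumes \<omega>: "\<And>k. \<omega> k > 0"
  shows "inner_function \<omega> (\<lambda>z. c * z ^ s) \<longleftrightarrow> (cmod c)\<^sup>2 * \<omega> s = 1"
proof -
  let ?f = "\<lambda>z. c * z ^ s"
  have "(\<lambda>k. (cmod (taylor_coeff ?f k))\<^sup>2 * \<omega> k) = (\<lambda>k. if k = s then (cmod c)\<^sup>2 * \<omega> s else 0)"
    by (auto simp: taylor_coeff_monomial)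
  then have mem: "?f \<in> hardy_space \<omega>"
    unfolding hardy_space_def by (auto intro!: holomorphic_intros)
  have "hardy_inner \<omega> (\<lambda>z. z ^ k * ?f z) ?f = (if k = 0 then of_real ((cmod c)\<^sup>2 * \<omega> s) else 0)" for k
  proof -
    have "(\<lambda>z. z ^ k * ?f z) = (\<lambda>z. c * z ^ (s + k))"
      by (auto simp: power_add mult_ac)
    then have "hardy_inner \<omega> (\<lambda>z. z ^ k * ?f z) ?f
        = (\<Sum>n. if n = s then (if k = 0 then c * cnj c * of_real (\<omega> s) else 0) else 0)"
      unfolding hardy_inner_def by (intro suminf_cong) (auto simp: taylor_coeff_monomial)
    also have "\<dots> = (if k = 0 then of_real ((cmod c)\<^sup>2 * \<omega> s) else 0)"
      using sums_unique[OF sums_single[of s "\<lambda>_. if k = 0 then c * cnj c * of_real (\<omega> s) else 0"]]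
      by (simp add: complex_norm_square del: of_real_power)
    finally show ?thesis .
  qed
  then have "inner_function \<omega> ?f \<longleftrightarrow> complex_of_real ((cmod c)\<^sup>2 * \<omega> s) = 1"
    unfolding inner_function_def using mem by auto
  then show ?thesis
    using of_real_eq_1_iff by blast
qed

text \<open>
  After the shift by the order of vanishing \<open>s\<close>, the orthogonality relations have the form
  required by \<open>correlation_zero_imp_tail_zero\<close> with nonzero leading coefficient \<open>t s\<close>, and the
  conclusion that \<open>d n = 0\<close> for \<open>n > s\<close> says that no Taylor coefficient survives beyond \<open>s\<close>.
\<close>
lemma entire_inner_function_is_monomial:
  fixes \<omega> :: "nat \<Rightarrow> real"
  assumes pos: "\<And>k. \<omega> k > 0"
    and lim: "(\<lambda>k. \<omega> k / \<omega> (k + 1)) \<longlonglongrightarrow> 1"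
    and entire: "f holomorphic_on UNIV"
    and inner: "inner_function \<omega> f"
  obtains s c where "f = (\<lambda>z. c * z ^ s)"
proof -
  define t where "t = taylor_coeff f"
  define d where "d n = cnj (t n) * of_real (\<omega> n)" for n
  have ip: "hardy_inner \<omega> (\<lambda>z. z ^ k * f z) f = (\<Sum>n. (if n < k then 0 else t (n - k)) * d n)" for k
    unfolding hardy_inner_def taylor_coeff_times_power[OF entire] t_def d_def
    by (simp add: mult.assoc)
  have "\<exists>n. t n \<noteq> 0"
  proof (rule ccontr)
    assume "\<nexists>n. t n \<noteq> 0"
    then have "hardy_inner \<omega> (\<lambda>z. z ^ 0 * f z) f = 0"
      unfolding ip by simp
    then show False
      using inner unfolding inner_function_def by (metis zero_neq_one)
  qed
  define s where "s = (LEAST n. t n \<noteq> 0)"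
  have ts: "t s \<noteq> 0"
    unfolding s_def using \<open>\<exists>n. t n \<noteq> 0\<close> by (rule LeastI_ex)
  have below: "t n = 0" if "n < s" for n
    using that not_less_Least unfolding s_def by blast
  define a where "a j = t (s + j)" for j
  define b where "b k = d (s + k)" for k
  obtain A where A: "\<And>n. cmod (t n) \<le> A"
    using taylor_coeff_entire_bound[OF entire, of 1] unfolding t_def by auto
  obtain M where M: "\<And>k. \<omega> k \<le> M * 2 ^ k"
    using weight_exponential_bound[OF pos lim] by blast
  have M0: "M \<ge> 0"
    using M[of 0] pos[of 0] by simp
  have d_small: "\<exists>K. \<forall>n. cmod (d n) * T ^ n \<le> K" if T: "T > 0" for T
  proof -
    obtain K where K: "\<And>n. cmod (t n) * (2 * T) ^ n \<le> K"
      using taylor_coeff_entire_bound[OF entire, of "2 * T"] T unfolding t_def by auto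
    have "cmod (d n) * T ^ n \<le> M * K" for n
    proof -
      have "cmod (d n) * T ^ n = \<omega> n * (cmod (t n) * T ^ n)"
        using pos[of n] by (simp add: d_def norm_mult)
      also have "\<dots> \<le> M * 2 ^ n * (cmod (t n) * T ^ n)"
        using M T by (intro mult_right_mono) auto
      also have "\<dots> = M * (cmod (t n) * (2 * T) ^ n)"
        by (simp add: power_mult_distrib)
      also have "\<dots> \<le> M * K"
        using K M0 by (intro mult_left_mono)
      finally show ?thesis .
    qed
    then show ?thesis by blast
  qed
  have b_small: "\<exists>K. \<forall>k. cmod (b k) * T ^ k \<le> K" if T: "T > 0" for T
  proof -
    obtain K where K: "\<And>n. cmod (d n) * T ^ n \<le> K"
      using d_small[OF T] by blast
    have "cmod (b k) * T ^ k \<le> K / T ^ s" for k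
      using K[of "s + k"] T by (simp add: b_def power_add field_simps)
    then show ?thesis by blast
  qed
  have corr: "(\<lambda>j. a j * b (j + k)) sums 0" if k: "k \<ge> 1" for k
  proof -
    let ?g = "\<lambda>n. (if n < k then 0 else t (n - k)) * d n"
    obtain K where K: "\<And>n. cmod (d n) * 2 ^ n \<le> K"
      using d_small[of 2] by auto
    have A0: "A \<ge> 0"
      using A[of 0] norm_ge_zero[of "t 0"] by linarith
    \<comment> \<open>The value of \<open>suminf\<close> gives information only for a convergent series.\<close>
    have "summable ?g"
    proof (rule summable_comparison_test')
      show "summable (\<lambda>n. A * K * (1/2) ^ n)"
        by (intro summable_mult summable_geometric) simp
      fix n
      have "cmod (d n) \<le> K * (1/2) ^ n"
        using K[of n] by (simp add: field_simps power_one_over)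
      then have "cmod (if n < k then 0 else t (n - k)) * cmod (d n) \<le> A * (K * (1/2) ^ n)"
        using A A0 by (intro mult_mono) auto
      then show "norm (?g n) \<le> A * K * (1/2) ^ n"
        by (simp add: norm_mult mult_ac)
    qed
    moreover have "suminf ?g = 0"
      using inner k unfolding inner_function_def ip by auto
    ultimately have "?g sums 0"
      by (simp add: sums_iff)
    moreover have "?g n = 0" if "n < s + k" for n
      using that below by auto
    ultimately have "(\<lambda>j. ?g (j + (s + k))) sums 0"
      by (subst sums_zero_iff_shift)
    then show ?thesis
      by (simp add: a_def b_def add_ac)
  qed
  have b0: "b k = 0" if "k \<ge> 1" for k
    using correlation_zero_imp_tail_zero[of a A b k] ts A b_small corr that
    by (simp add: a_def)
  have above: "t n = 0" if "n > s" for n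
    using b0[of "n - s"] that pos[of n] by (auto simp: b_def d_def)
  have "f z = t s * z ^ s" for z
  proof -
    have "(\<lambda>n. t n * z ^ n) = (\<lambda>n. if n = s then t n * z ^ n else 0)"
      using below above by (auto simp: fun_eq_iff neq_iff)
    then show ?thesis
      using sums_unique2[OF taylor_coeff_entire_sums[OF entire, of z]]
        sums_single[of s "\<lambda>n. t n * z ^ n"] unfolding t_def by simp
  qed
  then show thesis
    by (intro that[of "t s" s]) auto
qed

theorem theorem3p1:
  fixes \<omega> :: "nat \<Rightarrow> real" and C :: real and f :: "complex \<Rightarrow> complex"
  assumes "\<And>k. \<omega> k > 0"
    and "\<omega> 0 = 1"
    and "(\<lambda>k. \<omega> k / \<omega> (k + 1)) \<longlonglongrightarrow> 1"
    and "C > 0"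
    and "\<And>n k. n \<le> k \<Longrightarrow> k \<le> 2 * n \<Longrightarrow> \<omega> k / \<omega> n \<le> C"
    and "no_extraneous_zeros \<omega>"
    and "f holomorphic_on UNIV"
  shows "inner_function \<omega> f \<longleftrightarrow>
    (\<exists>(s::nat) (c::complex). (cmod c)\<^sup>2 * \<omega> s = 1 \<and> (\<forall>z. f z = c * z ^ s))"
proof
  assume inner: "inner_function \<omega> f"
  then obtain s c where f: "f = (\<lambda>z. c * z ^ s)"
    using entire_inner_function_is_monomial[OF assms(1,3,7)] by blast
  then have "(cmod c)\<^sup>2 * \<omega> s = 1"
    using inner inner_function_monomial_iff[OF assms(1)] by simp
  with f show "\<exists>s c. (cmod c)\<^sup>2 * \<omega> s = 1 \<and> (\<forall>z. f z = c * z ^ s)"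
    by auto
next
  assume "\<exists>s c. (cmod c)\<^sup>2 * \<omega> s = 1 \<and> (\<forall>z. f z = c * z ^ s)"
  then obtain s c where c: "(cmod c)\<^sup>2 * \<omega> s = 1" and "\<forall>z. f z = c * z ^ s"
    by blast
  then have "f = (\<lambda>z. c * z ^ s)"
    by auto
  with c show "inner_function \<omega> f"
    using inner_function_monomial_iff[OF assms(1)] by simp
qed

end
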